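(* Let $w\in S_n$ be an inverse fireworks permutation and let $m\in\mathrm{Supp}(\mathfrak{G}_w(\mathbf{x}))$. If the degree of $m$ is less than the degree of $\mathfrak{G}_w(\mathbf{x})$, then there exists $i$ such that $m\,x_i\in\mathrm{Supp}(\mathfrak{G}_w(\mathbf{x}))$.
   Context: Inverse fireworks. Split the one-line notation of a permutation into its maximal consecutive decreasing runs. The permutation is fireworks if the first numbers of the runs are increasing from left to right; $w$ is inverse fireworks if $w^{-1}$ is fireworks. Support. $\mathrm{Supp}(f)$ is the set of monomials appearing in the polynomial $f$ with nonzero coefficient. Grothendieck polynomials. Cells $(i,j)$ of the $n\times n$ grid are indexed by row $i$ from the top and column $j$ from the left. A pipe dream (PD) is a tiling of the $n\times n$ grid in which each cell with $i+j\le n$ is either a cross tile (strands meeting all four edges) or a bump tile (one strand joining the left and top edges, another joining the bottom and right edges), each cell with $i+j=n+1$ is a J-tile (one strand joining the left and top edges), and each cell with $i+j>n+1$ is blank. Pipes enter from the left and exit from the top; the pipe entering from row $p$ is called pipe $p$. Pipes are traced processing rows from bottom to top and cells in a row from left to right. At a cross tile where pipe $p$ enters from the left and pipe $q$ from the bottom: if $p$ and $q$ have not crossed before, they cross in this tile, $p$ exits right and $q$ exits top; otherwise $p$ exits top and $q$ exits right. (Equivalently, pipe $\max(p,q)$ exits top.) For $w\in S_n$, $\mathsf{PD}(w)$ is the set of PDs such that for each $c$ the pipe exiting at the top of column $c$ is pipe $w^{-1}(c)$. For a PD $P$, $\mathsf{wty}(P)$ is the set of cells that are cross tiles, and $\mathsf{wt}_P(\mathbf{x})=\prod_{(i,j)\in\mathsf{wty}(P)}x_i$.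 With $\ell(w)$ the number of inversions of $w$, the Grothendieck polynomial is defined as $$\mathfrak{G}_w(\mathbf{x})=\sum_{P\in\mathsf{PD}(w)}(-1)^{|\mathsf{wty}(P)|-\ell(w)}\,\mathsf{wt}_P(\mathbf{x}).$$ *)

theory Defs
  imports
    "HOL-Library.Poly_Mapping"
    "HOL-Combinatorics.Permutations"
begin

section \<open>Fireworks permutations\<close>

text \<open>Permutations in \<open>S\<^sub>n\<close> are functions \<open>w\<close> with \<open>w permutes {1..n}\<close>.\<close>

definition one_line :: "nat \<Rightarrow> (nat \<Rightarrow> nat) \<Rightarrow> nat list" where
  "one_line n w = map w [1..<Suc n]"

text \<open>The maximal consecutive decreasing runs of a list, from left to right.\<close>

fun decreasing_runs :: "nat list \<Rightarrow> nat list list" where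
  "decreasing_runs [] = []"
| "decreasing_runs [a] = [[a]]"
| "decreasing_runs (a # b # zs) =
     (if a > b then (a # hd (decreasing_runs (b # zs))) # tl (decreasing_runs (b # zs))
      else [a] # decreasing_runs (b # zs))"

definition fireworks :: "nat \<Rightarrow> (nat \<Rightarrow> nat) \<Rightarrow> bool" where
  "fireworks n w \<longleftrightarrow> sorted_wrt (<) (map hd (decreasing_runs (one_line n w)))"

definition inverse_fireworks :: "nat \<Rightarrow> (nat \<Rightarrow> nat) \<Rightarrow> bool" where
  "inverse_fireworks n w \<longleftrightarrow> fireworks n (inv w)"

definition perm_length :: "nat \<Rightarrow> (nat \<Rightarrow> nat) \<Rightarrow> nat" where
  "perm_length n w = card {(i, j). 1 \<le> i \<and> i < j \<and> j \<le> n \<and> w i > w j}"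


section \<open>Polynomials\<close>

text \<open>A monomial is its finitely supported exponent vector (so the product of monomials
  is \<open>+\<close>), and a polynomial maps monomials to their coefficients; multiplication of
  polynomials is the convolution product of the type \<open>\<Rightarrow>\<^sub>0\<close>.\<close>

type_synonym monom = "nat \<Rightarrow>\<^sub>0 nat"
type_synonym mpoly = "monom \<Rightarrow>\<^sub>0 int"

definition monom_var :: "nat \<Rightarrow> monom" where
  "monom_var i = Poly_Mapping.single i 1"

definition poly_var :: "nat \<Rightarrow> mpoly" where
  "poly_var i = Poly_Mapping.single (monom_var i) 1"

definition Supp :: "mpoly \<Rightarrow> monom set" where
  "Supp f = Poly_Mapping.keys f"

definition monom_degree :: "monom \<Rightarrow> nat" where
  "monom_degree m = (\<Sum>i\<in>Poly_Mapping.keys m. Poly_Mapping.lookup m i)"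

text \<open>The \<open>0\<close> only serves to give the zero polynomial degree \<open>0\<close>.\<close>

definition poly_degree :: "mpoly \<Rightarrow> nat" where
  "poly_degree f = Max (insert 0 (monom_degree ` Supp f))"


section \<open>Pipe dreams\<close>

datatype tile = Cross | Bump | J_tile | Blank

text \<open>Cells are pairs (row, column). Outside of the grid the tiling is \<open>Blank\<close> by
  convention, so that distinct functions are distinct tilings of the grid.\<close>

definition pipe_dreams :: "nat \<Rightarrow> (nat \<times> nat \<Rightarrow> tile) set" where
  "pipe_dreams n = {P. \<forall>i j.
     (if 1 \<le> i \<and> 1 \<le> j \<and> i + j \<le> n then P (i, j) \<in> {Cross, Bump}
      else if 1 \<le> i \<and> 1 \<le> j \<and> i + j = n + 1 then P (i, j) = J_tile
      else P (i, j) = Blank)}"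

text \<open>In a state \<open>(v, h, X)\<close> of the tracing of pipes, \<open>v c\<close> is the pipe at the current
  top end of column \<open>c\<close> (the bottom edge of the next cell of that column), \<open>h\<close> is the pipe
  at the left edge of the next cell of the current row, and \<open>X\<close> is the set of the unordered
  pairs of pipes that have crossed so far. The value \<open>0\<close> of \<open>v c\<close> or \<open>h\<close> stands for
  ``no pipe''.\<close>

type_synonym trace_state = "(nat \<Rightarrow> nat) \<times> nat \<times> nat set set"

fun trace_cell :: "tile \<Rightarrow> nat \<Rightarrow> trace_state \<Rightarrow> trace_state" where
  "trace_cell Cross c (v, h, X) =
     (if {h, v c} \<notin> X then (v, h, insert {h, v c} X) else (v(c := h), v c, X))"
| "trace_cell Bump c (v, h, X) = (v(c := h), v c, X)"
| "trace_cell J_tile c (v, h, X) = (v(c := h), 0, X)"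
| "trace_cell Blank c (v, h, X) = (v, h, X)"

text \<open>Row \<open>i\<close> is traced from left to right, with pipe \<open>i\<close> entering at its left end.\<close>

definition trace_row ::
  "nat \<Rightarrow> (nat \<times> nat \<Rightarrow> tile) \<Rightarrow> nat \<Rightarrow> trace_state \<Rightarrow> trace_state" where
  "trace_row n P i = (\<lambda>(v, h, X). fold (\<lambda>j. trace_cell (P (i, j)) j) [1..<Suc n] (v, i, X))"

definition trace_pipes :: "nat \<Rightarrow> (nat \<times> nat \<Rightarrow> tile) \<Rightarrow> trace_state" where
  "trace_pipes n P = fold (trace_row n P) (rev [1..<Suc n]) (\<lambda>_. 0, 0, {})"

definition exit_pipe :: "nat \<Rightarrow> (nat \<times> nat \<Rightarrow> tile) \<Rightarrow> nat \<Rightarrow> nat" where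
  "exit_pipe n P c = fst (trace_pipes n P) c"

definition PD :: "nat \<Rightarrow> (nat \<Rightarrow> nat) \<Rightarrow> (nat \<times> nat \<Rightarrow> tile) set" where
  "PD n w = {P \<in> pipe_dreams n. \<forall>c\<in>{1..n}. exit_pipe n P c = inv w c}"

definition wty :: "(nat \<times> nat \<Rightarrow> tile) \<Rightarrow> (nat \<times> nat) set" where
  "wty P = {z. P z = Cross}"

lemma finite_pipe_dreams: "finite (pipe_dreams n)"
proof -
  let ?F = "{P :: nat \<times> nat \<Rightarrow> tile. \<forall>z. (z \<in> {1..n} \<times> {1..n} \<longrightarrow> P z \<in> {Cross, Bump, J_tile, Blank})
               \<and> (z \<notin> {1..n} \<times> {1..n} \<longrightarrow> P z = Blank)}"
  have "finite ?F"
    by (rule finite_set_of_finite_funs) auto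
  moreover have "pipe_dreams n \<subseteq> ?F"
  proof
    fix P assume P: "P \<in> pipe_dreams n"
    have "P (i, j) = Blank" if "(i, j) \<notin> {1..n} \<times> {1..n}" for i j
    proof -
      have "\<not> (1 \<le> i \<and> 1 \<le> j \<and> i + j \<le> n)" "\<not> (1 \<le> i \<and> 1 \<le> j \<and> i + j = n + 1)"
        using that by auto
      then show ?thesis
        using P unfolding pipe_dreams_def mem_Collect_eq by presburger
    qed
    moreover have "t \<in> {Cross, Bump, J_tile, Blank}" for t
      by (cases t) auto
    ultimately show "P \<in> ?F" by auto
  qed
  ultimately show ?thesis by (rule rev_finite_subset)
qed

lemma finite_PD: "finite (PD n w)"
  by (rule finite_subset[OF _ finite_pipe_dreams]) (auto simp: PD_def)

lemma finite_wty: "P \<in> pipe_dreams n \<Longrightarrow> finite (wty P)"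
proof (rule finite_subset)
  assume P: "P \<in> pipe_dreams n"
  show "wty P \<subseteq> {1..n} \<times> {1..n}"
  proof
    fix z assume "z \<in> wty P"
    then obtain i j where z: "z = (i, j)" and c: "P (i, j) = Cross"
      by (cases z) (auto simp: wty_def)
    have "1 \<le> i \<and> 1 \<le> j \<and> i + j \<le> n"
      using P c unfolding pipe_dreams_def mem_Collect_eq by (metis tile.distinct(3,5))
    then show "z \<in> {1..n} \<times> {1..n}" using z by auto
  qed
qed simp


section \<open>Grothendieck polynomials\<close>

definition pd_weight :: "(nat \<times> nat \<Rightarrow> tile) \<Rightarrow> mpoly" where
  "pd_weight P = (\<Prod>(i, j)\<in>wty P. poly_var i)"

text \<open>The subtraction in the exponent does not truncate: every pipe dream of \<open>w\<close> has at
  least \<open>\<ell>(w)\<close> cross tiles.\<close>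

definition grothendieck :: "nat \<Rightarrow> (nat \<Rightarrow> nat) \<Rightarrow> mpoly" where
  "grothendieck n w =
     (\<Sum>P\<in>PD n w. (- 1) ^ (card (wty P) - perm_length n w) * pd_weight P)"

end

theory Submission
  imports Defs
begin

text \<open>
  All pipe dreams of \<open>w\<close> with weight \<open>m\<close> contribute to \<open>m\<close> with the same sign, so the support
  of the Grothendieck polynomial is the set of weights of pipe dreams (\<open>Supp_grothendieck\<close>).
  It remains to take a pipe dream of non-maximal degree and find one with exactly one more
  cross.

  Between two rows a pipe dream is described by the word of the pipes at the tops of the
  columns. A row carries its new pipe \<open>h\<close> along this word from left to right. At an entry \<open>x\<close>
  either \<open>x\<close> stays and \<open>h\<close> passes it (a cross tile, for uncrossed \<open>h < x\<close>), or \<open>h\<close> is put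
  down and \<open>x\<close> is carried on. The latter is forced if \<open>x < h\<close>, and then the tile may be
  a cross or a bump; it is voluntary if \<open>h < x\<close>, and then the tile is a bump and \<open>x\<close> is
  called bumped. If some forced tile is not a cross, making it one finishes the proof.
  So let the pipe dream be saturated: all forced tiles are crosses. Its degree is then the
  number of cells minus the number of voluntary bumps.

  A record \<open>q\<close> of the final word (all earlier entries are smaller) is met once in every row
  above its own: it is passed by a smaller pipe, or voluntarily bumped, but never met by
  a larger pipe, as a larger pipe would end up on its left. Hence the number of times that it
  is bumped depends only on its position in the final word (\<open>saturated_record\<close>). A saturated
  pipe dream of non-maximal degree therefore bumps some \<open>q\<close> that is not a record.

  Follow the bumped \<open>q\<close> upwards. It is put down to the right of a smaller neighbour, and
  this persists in the later words (possibly with another neighbour, or with \<open>q\<close> bumped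
  again), unless at some row the word \<open>v\<close> entering the row can be replaced by the word with
  two adjacent entries \<open>x < y\<close> exchanged, with the same result and the same number
  of crosses in that row (\<open>sweep_bumped\<close>). In the final word of an inverse fireworks
  permutation an entry with a smaller left neighbour begins a run and hence is a record,
  so an exchange must occur.

  A pipe dream for the exchanged word is found by pushing the exchange down through the rows
  until it is absorbed in one of them (\<open>sweep_swap_rise\<close>). The absorbing row gains one cross,
  and then the proof is finished, or keeps its number of crosses. In the second case
  the weight is unchanged, but at least one intermediate word has lost a rise and none has
  gained one, so the total number of rises decreases and the argument can be repeated
  (\<open>saturated_extend\<close>).
\<close>

section \<open>The support as a set of weights\<close>

lemma monom_degree_superset:
  assumes "finite A" "Poly_Mapping.keys m \<subseteq> A"
  shows "monom_degree m = (\<Sum>i\<in>A. Poly_Mapping.lookup m i)"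
  unfolding monom_degree_def using assms
  by (intro sum.mono_neutral_left) (auto simp: in_keys_iff)

lemma monom_degree_add: "monom_degree (a + b) = monom_degree a + monom_degree b"
proof -
  let ?A = "Poly_Mapping.keys a \<union> Poly_Mapping.keys b"
  have "Poly_Mapping.keys (a + b) \<subseteq> ?A" by (rule Poly_Mapping.keys_add)
  then have "monom_degree (a + b) = (\<Sum>i\<in>?A. Poly_Mapping.lookup (a + b) i)"
    by (intro monom_degree_superset) auto
  then show ?thesis
    by (simp add: lookup_add sum.distrib monom_degree_superset[of ?A])
qed

lemma monom_degree_single [simp]: "monom_degree (Poly_Mapping.single i a) = a"
  by (cases "a = 0") (auto simp: monom_degree_def)

lemma monom_degree_0 [simp]: "monom_degree 0 = 0"
  by (simp add: monom_degree_def)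

definition wt :: "(nat \<times> nat \<Rightarrow> tile) \<Rightarrow> monom" where
  "wt P = (\<Sum>(i, j)\<in>wty P. monom_var i)"

lemma prod_poly_var: "(\<Prod>z\<in>A. poly_var (f z)) = Poly_Mapping.single (\<Sum>z\<in>A. monom_var (f z)) 1"
  by (induction A rule: infinite_finite_induct) (auto simp: poly_var_def mult_single)

lemma pd_weight_eq: "pd_weight P = Poly_Mapping.single (wt P) 1"
  unfolding pd_weight_def wt_def by (simp add: case_prod_beta prod_poly_var)

lemma monom_degree_wt: "monom_degree (wt P) = card (wty P)"
proof -
  have "monom_degree (\<Sum>z\<in>A. monom_var (f z)) = card A" if "finite A"
    for A :: "(nat \<times> nat) set" and f
    using that by (induction A rule: finite_induct) (auto simp: monom_degree_add monom_var_def)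
  moreover have "monom_degree (wt P) = card (wty P)" if "infinite (wty P)"
    using that by (simp add: wt_def)
  ultimately show ?thesis unfolding wt_def by (cases "finite (wty P)") (auto simp: case_prod_beta)
qed

text \<open>The number of crosses is the degree of the weight, so the sign of a pipe dream depends only
  on its weight and equal monomials cannot cancel.\<close>

lemma Supp_grothendieck: "Supp (grothendieck n w) = wt ` PD n w"
proof -
  have "Poly_Mapping.lookup (grothendieck n w) m =
    (- 1) ^ (monom_degree m - perm_length n w) * int (card {P \<in> PD n w. wt P = m})" for m
  proof -
    have sgn: "(- 1) ^ k * Poly_Mapping.single x (1::int) = Poly_Mapping.single x ((- 1) ^ k)"
      for k :: nat and x :: monom
      by (induction k) (auto simp: single_uminus)
    have "Poly_Mapping.lookup (grothendieck n w) m =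
      (\<Sum>P\<in>PD n w. (if wt P = m then (- 1) ^ (monom_degree m - perm_length n w) else 0))"
      unfolding grothendieck_def lookup_sum
      by (intro sum.cong)
         (auto simp: pd_weight_eq sgn lookup_single when_def monom_degree_wt[symmetric])
    also have "\<dots> = (- 1) ^ (monom_degree m - perm_length n w) * int (card {P \<in> PD n w. wt P = m})"
      by (simp add: sum.If_cases finite_PD Int_def)
    finally show ?thesis .
  qed
  then show ?thesis
    by (auto simp: Supp_def in_keys_iff finite_PD)
qed

section \<open>Pipe dreams as sequences of words\<close>

text \<open>The word above a row, computed from the word \<open>v\<close> below it; the bits tell which cells are
  crosses. The comparison \<open>h < x\<close> replaces the record of past crossings: two pipes have
  crossed before exactly if the larger one comes first. The equation for \<open>[]\<close> agrees with
  a row of bumps, and the last carried pipe leaves through the J-tile.\<close>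

fun row_word :: "bool list \<Rightarrow> nat \<Rightarrow> nat list \<Rightarrow> nat list" where
  "row_word [] h v = h # v"
| "row_word (b # bs) h [] = [h]"
| "row_word (b # bs) h (x # v) =
     (if b \<and> h < x then x # row_word bs h v else h # row_word bs x v)"

lemma row_word_Nil [simp]: "row_word bs h [] = [h]"
  by (cases bs) auto

lemma length_row_word [simp]: "length (row_word bs h v) = Suc (length v)"
  by (induction bs h v rule: row_word.induct) auto

lemma mset_row_word [simp]: "mset (row_word bs h v) = add_mset h (mset v)"
  by (induction bs h v rule: row_word.induct) auto

fun word :: "nat \<Rightarrow> (nat \<Rightarrow> bool list) \<Rightarrow> nat \<Rightarrow> nat list" where
  "word n C 0 = []"
| "word n C (Suc k) = row_word (C (n - k)) (n - k) (word n C k)"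

lemma length_word [simp]: "length (word n C k) = k"
  by (induction k) auto

lemma mset_word: "k \<le> n \<Longrightarrow> mset (word n C k) = mset [Suc (n - k)..<Suc n]"
proof (induction k)
  case (Suc k)
  have "[Suc (n - Suc k)..<Suc n] = (n - k) # [Suc (n - k)..<Suc n]"
    using Suc.prems upt_conv_Cons[of "n - k" "Suc n"] by (simp add: Suc_diff_Suc)
  then show ?case using Suc by simp
qed simp

lemma distinct_word: "k \<le> n \<Longrightarrow> distinct (word n C k)"
  using mset_word[of k n C] mset_eq_imp_distinct_iff distinct_upt by blast

lemma set_word: "k \<le> n \<Longrightarrow> set (word n C k) = {Suc (n - k)..n}"
  using mset_word[of k n C] by (metis atLeastLessThanSuc_atLeastAtMost mset_eq_setD set_upt)

text \<open>The set of crossed pairs that belongs to the order of the pipes along the current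
  frontier.\<close>

fun invs :: "nat list \<Rightarrow> nat set set" where
  "invs [] = {}"
| "invs (x # xs) = {{x, y} |y. y \<in> set xs \<and> y < x} \<union> invs xs"

lemma invs_subset: "s \<in> invs L \<Longrightarrow> s \<subseteq> set L"
  by (induction L) auto

lemma invs_swap: "h < x \<Longrightarrow> invs (d @ x # h # r) = insert {h, x} (invs (d @ h # x # r))"
proof (induction d)
  case Nil
  then show ?case by (auto simp: insert_commute)
next
  case (Cons a d)
  have "set (d @ x # h # r) = set (d @ h # x # r)" by auto
  then show ?case using Cons by (simp only: append_Cons invs.simps) (simp add: Un_insert_right)
qed

lemma invs_adjacent:
  "distinct (d @ h # x # r) \<Longrightarrow> {h, x} \<in> invs (d @ h # x # r) \<longleftrightarrow> x < h"
proof (induction d)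
  case Nil
  then show ?case by (auto simp: doubleton_eq_iff dest: invs_subset)
next
  case (Cons a d)
  have "{h, x} \<noteq> {a, y}" for y
    using Cons.prems by (auto simp: doubleton_eq_iff)
  then show ?case using Cons by simp
qed

definition cols :: "nat list \<Rightarrow> nat \<Rightarrow> nat" where
  "cols W c = (if 1 \<le> c \<and> c \<le> length W then W ! (c - 1) else 0)"

lemma cols_at [simp]: "cols (d @ x # r) (Suc (length d)) = x"
  by (simp add: cols_def)

lemma cols_upd [simp]: "(cols (d @ x # r))(Suc (length d) := h) = cols (d @ h # r)"
  by (rule ext) (auto simp: cols_def nth_append nth_Cons split: nat.split)

lemma cols_snoc [simp]: "(cols d)(Suc (length d) := h) = cols (d @ [h])"
  by (rule ext) (auto simp: cols_def nth_append)

definition cross_bits :: "nat \<Rightarrow> (nat \<times> nat \<Rightarrow> tile) \<Rightarrow> nat \<Rightarrow> bool list" where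
  "cross_bits n P i = map (\<lambda>j. P (i, j) = Cross) [1..<Suc (n - i)]"

lemma pipe_dreamsD:
  assumes "P \<in> pipe_dreams n"
  shows "1 \<le> i \<Longrightarrow> 1 \<le> j \<Longrightarrow> i + j \<le> n \<Longrightarrow> P (i, j) = Cross \<or> P (i, j) = Bump"
    and "1 \<le> i \<Longrightarrow> 1 \<le> j \<Longrightarrow> i + j = Suc n \<Longrightarrow> P (i, j) = J_tile"
    and "i + j > Suc n \<Longrightarrow> P (i, j) = Blank"
    and "P (i, j) = Cross \<Longrightarrow> 1 \<le> i \<and> 1 \<le> j \<and> i + j \<le> n"
proof -
  have *: "if 1 \<le> i \<and> 1 \<le> j \<and> i + j \<le> n then P (i, j) \<in> {Cross, Bump}
      else if 1 \<le> i \<and> 1 \<le> j \<and> i + j = n + 1 then P (i, j) = J_tile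
      else P (i, j) = Blank"
    using assms unfolding pipe_dreams_def by blast
  show "1 \<le> i \<Longrightarrow> 1 \<le> j \<Longrightarrow> i + j \<le> n \<Longrightarrow> P (i, j) = Cross \<or> P (i, j) = Bump"
    and "1 \<le> i \<Longrightarrow> 1 \<le> j \<Longrightarrow> i + j = Suc n \<Longrightarrow> P (i, j) = J_tile"
    and "i + j > Suc n \<Longrightarrow> P (i, j) = Blank"
    and "P (i, j) = Cross \<Longrightarrow> 1 \<le> i \<and> 1 \<le> j \<and> i + j \<le> n"
    using * by (auto split: if_splits simp del: One_nat_def)
qed

lemma fold_blank:
  assumes "\<forall>j\<in>set js. P (i, j) = Blank"
  shows "fold (\<lambda>j. trace_cell (P (i, j)) j) js s = s"
proof -
  have "trace_cell Blank j s = s" for j s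
    by (cases s) simp
  then show ?thesis using assms by (induction js arbitrary: s) auto
qed

text \<open>While a row is traced, the frontier reads \<open>d\<close>, then the carried pipe \<open>h\<close>, then \<open>r\<close>. A bump
  does not change this list, and a cross exchanges \<open>h\<close> with the head of \<open>r\<close> if that is
  larger. This keeps the set of crossed pairs equal to the inversions of the list.\<close>

lemma trace_row_from:
  assumes P: "P \<in> pipe_dreams n" and i: "1 \<le> i" "i \<le> n"
  shows "length (d @ r) = n - i \<Longrightarrow> distinct (d @ h # r) \<Longrightarrow>
    fold (\<lambda>j. trace_cell (P (i, j)) j) [Suc (length d)..<Suc n]
      (cols (d @ r), h, invs (d @ h # r)) =
    (let W = d @ row_word (map (\<lambda>j. P (i, j) = Cross) [Suc (length d)..<Suc (n - i)]) h r
     in (cols W, 0, invs W))"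
proof (induction r arbitrary: d h)
  case Nil
  let ?j = "Suc (length d)"
  have j: "i + ?j = Suc n" using Nil i by auto
  have tile: "P (i, ?j) = J_tile" using pipe_dreamsD(2)[OF P, of i ?j] i j by auto
  have blank: "\<forall>j\<in>set [Suc ?j..<Suc n]. P (i, j) = Blank"
    using pipe_dreamsD(3)[OF P, of i] j by auto
  have js: "[?j..<Suc n] = ?j # [Suc ?j..<Suc n]"
    using i j by (intro upt_conv_Cons) auto
  show ?case
    unfolding js by (simp add: tile fold_blank[OF blank] Let_def del: upt_Suc)
next
  case (Cons x r)
  let ?j = "Suc (length d)"
  have j: "i + ?j \<le> n" using Cons.prems i by auto
  have tile: "P (i, ?j) = Cross \<or> P (i, ?j) = Bump" using pipe_dreamsD(1)[OF P, of i ?j] i j by auto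
  have js: "[?j..<Suc n] = ?j # [Suc ?j..<Suc n]"
    using i j by (intro upt_conv_Cons) auto
  have js': "[?j..<Suc (n - i)] = ?j # [Suc ?j..<Suc (n - i)]"
    using i j by (intro upt_conv_Cons) auto
  have hx: "h \<noteq> x" using Cons.prems by auto
  have adj: "{h, x} \<in> invs (d @ h # x # r) \<longleftrightarrow> x < h"
    using invs_adjacent Cons.prems by blast
  show ?case
  proof (cases "P (i, ?j) = Cross \<and> h < x")
    case True
    then show ?thesis
      unfolding js js' using Cons.IH[of "d @ [x]" h] Cons.prems adj
      by (simp add: invs_swap[symmetric] del: upt_Suc)
  next
    case False
    then show ?thesis
      unfolding js js' using Cons.IH[of "d @ [h]" x] Cons.prems adj tile hx
      by (auto simp del: upt_Suc)
  qed
qed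

lemma trace_rows:
  assumes P: "P \<in> pipe_dreams n"
  shows "k \<le> n \<Longrightarrow> fold (trace_row n P) (rev [Suc (n - k)..<Suc n]) (\<lambda>_. 0, 0, {}) =
    (cols (word n (cross_bits n P) k), 0, invs (word n (cross_bits n P) k))"
proof (induction k)
  case 0
  then show ?case by (auto simp: cols_def)
next
  case (Suc k)
  let ?v = "word n (cross_bits n P) k"
  have split: "[Suc (n - Suc k)..<Suc n] = (n - k) # [Suc (n - k)..<Suc n]"
    using Suc.prems upt_conv_Cons[of "n - k" "Suc n"] by (simp add: Suc_diff_Suc)
  have dist: "distinct ((n - k) # ?v)" and less: "\<forall>y\<in>set ?v. n - k < y"
    using Suc.prems distinct_word[of k n] set_word[of k n] by auto
  have inv: "invs ((n - k) # ?v) = invs ?v" using less by auto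
  have "fold (\<lambda>j. trace_cell (P (n - k, j)) j) [1..<Suc n] (cols ?v, n - k, invs ?v) =
    (let W = row_word (cross_bits n P (n - k)) (n - k) ?v in (cols W, 0, invs W))"
    using trace_row_from[OF P, of "n - k" "[]" ?v "n - k"] dist Suc.prems
    by (simp add: inv cross_bits_def[of n P "n - k"] del: upt_Suc invs.simps)
  then show ?case
    using Suc by (simp add: split trace_row_def Let_def del: upt_Suc)
qed

lemma exit_pipe_eq:
  assumes "P \<in> pipe_dreams n"
  shows "exit_pipe n P c = cols (word n (cross_bits n P) n) c"
  using trace_rows[OF assms, of n] by (simp add: exit_pipe_def trace_pipes_def del: upt_Suc)

lemma PD_iff_word:
  "P \<in> PD n w \<longleftrightarrow> P \<in> pipe_dreams n \<and> word n (cross_bits n P) n = one_line n (inv w)"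
proof -
  have "(\<forall>c\<in>{1..n}. cols W c = inv w c) \<longleftrightarrow> W = one_line n (inv w)" if "length W = n" for W
  proof
    assume *: "\<forall>c\<in>{1..n}. cols W c = inv w c"
    show "W = one_line n (inv w)"
    proof (rule nth_equalityI)
      fix i assume "i < length W"
      then show "W ! i = one_line n (inv w) ! i"
        using *[rule_format, of "Suc i"] that by (simp add: cols_def one_line_def del: upt_Suc)
    qed (simp add: one_line_def that)
  qed (auto simp: cols_def one_line_def nth_append simp del: upt_Suc)
  then have "(\<forall>c\<in>{1..n}. cols (word n (cross_bits n P) n) c = inv w c) \<longleftrightarrow>
      word n (cross_bits n P) n = one_line n (inv w)" by simp
  then show ?thesis unfolding PD_def using exit_pipe_eq by auto
qed


text \<open>\<open>reach n k v m\<close>: the lowest \<open>k\<close> rows can be tiled with row weight \<open>m\<close> so that the word above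
  them is \<open>v\<close>.\<close>

inductive reach :: "nat \<Rightarrow> nat \<Rightarrow> nat list \<Rightarrow> monom \<Rightarrow> bool" for n where
  reach_0: "reach n 0 [] 0"
| reach_Suc: "reach n k v m \<Longrightarrow> k < n \<Longrightarrow> length bs = k \<Longrightarrow>
    reach n (Suc k) (row_word bs (n - k) v)
      (m + Poly_Mapping.single (n - k) (count_list bs True))"

definition rows_weight :: "nat \<Rightarrow> (nat \<Rightarrow> bool list) \<Rightarrow> nat \<Rightarrow> monom" where
  "rows_weight n C k = (\<Sum>j<k. Poly_Mapping.single (n - j) (count_list (C (n - j)) True))"

lemma reach_word:
  assumes "\<And>i. length (C i) = n - i"
  shows "k \<le> n \<Longrightarrow> reach n k (word n C k) (rows_weight n C k)"
proof (induction k)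
  case 0
  then show ?case by (simp add: rows_weight_def reach_0)
next
  case (Suc k)
  then show ?case
    using reach_Suc[of n k "word n C k" "rows_weight n C k" "C (n - k)"] assms
    by (simp add: rows_weight_def)
qed

lemma word_cong: "(\<And>j. j < k \<Longrightarrow> C (n - j) = C' (n - j)) \<Longrightarrow> word n C k = word n C' k"
  by (induction k) auto

lemma reach_imp_word:
  assumes "reach n k v m"
  shows "k \<le> n \<and> (\<exists>C. (\<forall>i. length (C i) = n - i) \<and> v = word n C k \<and> m = rows_weight n C k)"
  using assms
proof induction
  case reach_0
  show ?case by (auto simp: rows_weight_def intro!: exI[of _ "\<lambda>i. replicate (n - i) False"])
next
  case (reach_Suc k v m bs)
  then obtain C where C: "\<forall>i. length (C i) = n - i" "v = word n C k" "m = rows_weight n C k"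
    by auto
  define D where "D = C(n - k := bs)"
  have len: "\<forall>i. length (D i) = n - i" and new: "D (n - k) = bs"
    using C reach_Suc.hyps by (auto simp: D_def)
  have same: "D (n - j) = C (n - j)" if "j < k" for j
    using that reach_Suc.hyps by (auto simp: D_def)
  have "word n D k = word n C k" using same by (intro word_cong) auto
  moreover have "rows_weight n D k = rows_weight n C k"
    unfolding rows_weight_def using same by (intro sum.cong) auto
  ultimately have "row_word bs (n - k) v = word n D (Suc k)"
    "m + Poly_Mapping.single (n - k) (count_list bs True) = rows_weight n D (Suc k)"
    using C new by (simp_all add: rows_weight_def)
  then show ?case using len reach_Suc.hyps by (intro conjI exI[of _ D]) auto
qed

lemma wt_eq_rows_weight:
  assumes P: "P \<in> pipe_dreams n"
  shows "wt P = rows_weight n (cross_bits n P) n"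
proof -
  let ?A = "\<lambda>i. {j \<in> {1..n - i}. P (i, j) = Cross}"
  have single: "(\<Sum>j\<in>A. monom_var i) = Poly_Mapping.single i (card A)" if "finite A"
    for A :: "nat set" and i
    using that by induction (auto simp: monom_var_def single_add[symmetric] simp del: sum_constant)
  have bits: "count_list (cross_bits n P i) True = card (?A i)" for i
  proof -
    have "count_list (cross_bits n P i) True =
      length (filter (\<lambda>j. P (i, j) = Cross) [1..<Suc (n - i)])"
    proof -
      have "count_list (map f xs) True = length (filter f xs)" for f :: "nat \<Rightarrow> bool" and xs
        by (induction xs) auto
      then show ?thesis by (simp add: cross_bits_def del: upt_Suc)
    qed
    also have "\<dots> = card (set (filter (\<lambda>j. P (i, j) = Cross) [1..<Suc (n - i)]))"
      by (rule distinct_card[symmetric]) simp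
    also have "set (filter (\<lambda>j. P (i, j) = Cross) [1..<Suc (n - i)]) = ?A i"
      by (auto simp del: upt_Suc)
    finally show ?thesis .
  qed
  have "wty P = Sigma {1..n} ?A"
    using pipe_dreamsD(4)[OF P] by (fastforce simp: wty_def)
  then have "wt P = (\<Sum>i\<in>{1..n}. \<Sum>j\<in>?A i. monom_var i)"
    unfolding wt_def by (simp add: sum.Sigma del: sum_constant)
  also have "\<dots> = (\<Sum>i\<in>{1..n}. Poly_Mapping.single i (count_list (cross_bits n P i) True))"
    by (intro sum.cong) (auto simp: bits single simp del: sum_constant)
  also have "\<dots> = rows_weight n (cross_bits n P) n"
    unfolding rows_weight_def
    by (rule sum.reindex_bij_witness[of _ "\<lambda>j. n - j" "\<lambda>i. n - i"]) auto
  finally show ?thesis .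
qed

definition pd_of_bits :: "nat \<Rightarrow> (nat \<Rightarrow> bool list) \<Rightarrow> nat \<times> nat \<Rightarrow> tile" where
  "pd_of_bits n C = (\<lambda>(i, j).
     if 1 \<le> i \<and> 1 \<le> j \<and> i + j \<le> n then (if C i ! (j - 1) then Cross else Bump)
     else if 1 \<le> i \<and> 1 \<le> j \<and> i + j = n + 1 then J_tile else Blank)"

lemma pd_of_bits: "pd_of_bits n C \<in> pipe_dreams n"
  by (auto simp: pd_of_bits_def pipe_dreams_def)

lemma cross_bits_pd_of_bits:
  "1 \<le> i \<Longrightarrow> length (C i) = n - i \<Longrightarrow> cross_bits n (pd_of_bits n C) i = C i"
  by (rule nth_equalityI) (auto simp: cross_bits_def pd_of_bits_def simp del: upt_Suc)

lemma Supp_iff_reach: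
  "m \<in> Supp (grothendieck n w) \<longleftrightarrow> reach n n (one_line n (inv w)) m"
proof
  assume "m \<in> Supp (grothendieck n w)"
  then obtain P where P: "P \<in> PD n w" "m = wt P" by (auto simp: Supp_grothendieck)
  have "length (cross_bits n P i) = n - i" for i
    by (simp add: cross_bits_def del: upt_Suc)
  from reach_word[of "cross_bits n P" n n, OF this] show "reach n n (one_line n (inv w)) m"
    using P by (auto simp: PD_iff_word wt_eq_rows_weight)
next
  assume "reach n n (one_line n (inv w)) m"
  then obtain C where C: "\<forall>i. length (C i) = n - i" "one_line n (inv w) = word n C n"
      "m = rows_weight n C n"
    using reach_imp_word by blast
  let ?P = "pd_of_bits n C"
  have same: "cross_bits n ?P (n - j) = C (n - j)" if "j < n" for j
    using that C by (intro cross_bits_pd_of_bits) auto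
  have "word n (cross_bits n ?P) n = word n C n" using same by (intro word_cong) auto
  moreover have "wt ?P = m"
    unfolding C wt_eq_rows_weight[OF pd_of_bits] rows_weight_def
    using same by (intro sum.cong) auto
  ultimately have "?P \<in> PD n w" "wt ?P = m" using C by (auto simp: PD_iff_word pd_of_bits)
  then show "m \<in> Supp (grothendieck n w)" by (auto simp: Supp_grothendieck)
qed

section \<open>Saturated pipe dreams\<close>

text \<open>A saturated row: \<open>h\<close> is carried along \<open>v\<close>, \<open>a\<close> is the number of crosses when every forced
  tile is one, \<open>u\<close> is the resulting word and \<open>B\<close> consists of the bumped pipes. Allowing
  \<open>x = h\<close> in the forced case avoids distinctness assumptions.\<close>

inductive sweep :: "nat \<Rightarrow> nat list \<Rightarrow> nat \<Rightarrow> nat list \<Rightarrow> nat multiset \<Rightarrow> bool" where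
  sweep_Nil: "sweep h [] 0 [h] {#}"
| sweep_pass: "h < x \<Longrightarrow> sweep h v a u B \<Longrightarrow> sweep h (x # v) (Suc a) (x # u) B"
| sweep_vol: "h < x \<Longrightarrow> sweep x v a u B \<Longrightarrow> sweep h (x # v) a (h # u) (add_mset x B)"
| sweep_forced: "x \<le> h \<Longrightarrow> sweep x v a u B \<Longrightarrow> sweep h (x # v) (Suc a) (h # u) B"

lemma sweep_mset: "sweep h v a u B \<Longrightarrow> mset u = add_mset h (mset v)"
  by (induction rule: sweep.induct) auto

lemma sweep_bumped_subset: "sweep h v a u B \<Longrightarrow> set_mset B \<subseteq> set v"
  by (induction rule: sweep.induct) auto

lemma sweep_size: "sweep h v a u B \<Longrightarrow> a + size B = length v"
  by (induction rule: sweep.induct) auto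

lemma sweep_imp_row_word:
  "sweep h v a u B \<Longrightarrow> \<exists>bs. length bs = length v \<and> row_word bs h v = u \<and> count_list bs True = a"
proof (induction rule: sweep.induct)
  case (sweep_pass h x v a u B)
  then obtain bs where "length bs = length v \<and> row_word bs h v = u \<and> count_list bs True = a" by blast
  then show ?case using sweep_pass.hyps by (intro exI[of _ "True # bs"]) auto
next
  case (sweep_vol h x v a u B)
  then obtain bs where "length bs = length v \<and> row_word bs x v = u \<and> count_list bs True = a" by blast
  then show ?case using sweep_vol.hyps by (intro exI[of _ "False # bs"]) auto
next
  case (sweep_forced x h v a u B)
  then obtain bs where "length bs = length v \<and> row_word bs x v = u \<and> count_list bs True = a" by blast
  then show ?case using sweep_forced.hyps by (intro exI[of _ "True # bs"]) auto
qed auto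

lemma row_word_saturate:
  "length bs = length v \<Longrightarrow>
    (\<exists>B. sweep h v (count_list bs True) (row_word bs h v) B) \<or>
    (\<exists>bs'. length bs' = length bs \<and> row_word bs' h v = row_word bs h v \<and>
       count_list bs' True = Suc (count_list bs True))"
proof (induction bs h v rule: row_word.induct)
  case (3 b bs h x v)
  show ?case
  proof (cases "b \<and> h < x")
    case True
    then consider B where "sweep h v (count_list bs True) (row_word bs h v) B"
      | bs' where "length bs' = length bs" "row_word bs' h v = row_word bs h v"
         "count_list bs' True = Suc (count_list bs True)"
      using 3 by auto
    then show ?thesis
    proof cases
      case 1
      then show ?thesis using True by (auto intro: sweep.intros)
    next
      case 2
      then show ?thesis using True by (intro disjI2 exI[of _ "b # bs'"]) auto
    qed
  next
    case False
    then consider B where "sweep x v (count_list bs True) (row_word bs x v) B"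
      | bs' where "length bs' = length bs" "row_word bs' x v = row_word bs x v"
         "count_list bs' True = Suc (count_list bs True)"
      using 3 by auto
    then show ?thesis
    proof cases
      case 1
      consider "h < x" | "x \<le> h" "b" | "x \<le> h" "\<not> b" by linarith
      then show ?thesis
      proof cases
        assume "x \<le> h" "\<not> b"
        then show ?thesis by (intro disjI2 exI[of _ "True # bs"]) auto
      qed (use 1 False in \<open>auto intro: sweep.intros\<close>)
    next
      case 2
      then show ?thesis using False by (intro disjI2 exI[of _ "b # bs'"]) auto
    qed
  qed
qed (auto intro: sweep.intros)

fun rises :: "nat list \<Rightarrow> nat" where
  "rises [] = 0"
| "rises (x # v) = size {#y \<in># mset v. x < y#} + rises v"

text \<open>\<open>N\<close> is the total number of rises of all words of the pipe dream, which serves as the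
  termination measure, and \<open>B\<close> collects the bumped pipes of all rows.\<close>

inductive saturated ::
  "nat \<Rightarrow> nat \<Rightarrow> nat list \<Rightarrow> monom \<Rightarrow> nat \<Rightarrow> nat multiset \<Rightarrow> bool" for n where
  saturated_0: "saturated n 0 [] 0 0 {#}"
| saturated_Suc: "saturated n k v m N B \<Longrightarrow> k < n \<Longrightarrow> sweep (n - k) v a u A \<Longrightarrow>
    saturated n (Suc k) u (m + Poly_Mapping.single (n - k) a) (N + rises u) (B + A)"

lemma saturated_mset:
  "saturated n k v m N B \<Longrightarrow> k \<le> n \<and> mset v = mset [Suc (n - k)..<Suc n]"
proof (induction rule: saturated.induct)
  case (saturated_Suc k v m N B a u A)
  have "[Suc (n - Suc k)..<Suc n] = (n - k) # [Suc (n - k)..<Suc n]"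
    using saturated_Suc.hyps upt_conv_Cons[of "n - k" "Suc n"] by (simp add: Suc_diff_Suc)
  then show ?case using saturated_Suc by (simp add: sweep_mset)
qed simp

lemma saturated_word:
  assumes "saturated n k v m N B"
  shows "k \<le> n" and "length v = k" and "distinct v" and "set v = {Suc (n - k)..n}"
proof -
  have k: "k \<le> n" and m: "mset v = mset [Suc (n - k)..<Suc n]"
    using saturated_mset[OF assms] by auto
  show "k \<le> n" by fact
  show "distinct v" using m mset_eq_imp_distinct_iff distinct_upt by blast
  show "set v = {Suc (n - k)..n}"
    using m by (metis atLeastLessThanSuc_atLeastAtMost mset_eq_setD set_upt)
  show "length v = k"
    using k m by (metis Suc_diff_Suc diff_Suc_Suc diff_diff_cancel length_upt mset_eq_length)
qed

lemma saturated_bumped_subset: "saturated n k v m N B \<Longrightarrow> set_mset B \<subseteq> set v"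
proof (induction rule: saturated.induct)
  case (saturated_Suc k v m N B a u A)
  have "set u = insert (n - k) (set v)"
    using sweep_mset[OF saturated_Suc.hyps(3)] by (metis set_mset_add_mset_insert set_mset_mset)
  then show ?case using saturated_Suc.IH sweep_bumped_subset[OF saturated_Suc.hyps(3)] by auto
qed simp

text \<open>In a saturated row each cell is either a cross or a voluntary bump.\<close>

lemma saturated_size: "saturated n k v m N B \<Longrightarrow> monom_degree m + size B = (\<Sum>j<k. j)"
proof (induction rule: saturated.induct)
  case (saturated_Suc k v m N B a u A)
  then have "a + size A = k" using sweep_size saturated_word(2) by metis
  then show ?case using saturated_Suc by (simp add: monom_degree_add)
qed simp

lemma reach_step:
  assumes "reach n k v m" "k < n" "sweep (n - k) v a u A" "length v = k"
  shows "reach n (Suc k) u (m + Poly_Mapping.single (n - k) a)"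
proof -
  obtain bs where "length bs = length v" "row_word bs (n - k) v = u" "count_list bs True = a"
    using sweep_imp_row_word[OF assms(3)] by blast
  then show ?thesis using reach_Suc[OF assms(1,2), of bs] assms(4) by simp
qed

lemma saturated_imp_reach: "saturated n k v m N B \<Longrightarrow> reach n k v m"
proof (induction rule: saturated.induct)
  case saturated_0
  show ?case by (rule reach_0)
next
  case (saturated_Suc k v m N B a u A)
  then show ?case using reach_step saturated_word(2) by metis
qed

definition extendable :: "nat \<Rightarrow> nat \<Rightarrow> nat list \<Rightarrow> monom \<Rightarrow> bool" where
  "extendable n k v m \<longleftrightarrow> (\<exists>i\<in>{1..n}. reach n k v (m + monom_var i))"

lemma extendable_row_word:
  assumes "extendable n k v m" "k < n" "length bs = k"
  shows "extendable n (Suc k) (row_word bs (n - k) v)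
    (m + Poly_Mapping.single (n - k) (count_list bs True))"
  using assms reach_Suc[of n k v _ bs] unfolding extendable_def
  by (metis add.assoc add.commute)

lemma extendable_sweep:
  assumes "extendable n k v m" "k < n" "sweep (n - k) v a u A" "length v = k"
  shows "extendable n (Suc k) u (m + Poly_Mapping.single (n - k) a)"
  using sweep_imp_row_word[OF assms(3)] extendable_row_word[OF assms(1,2)] assms(4) by metis

lemma reach_length: "reach n k v m \<Longrightarrow> length v = k"
  by (induction rule: reach.induct) auto

lemma reach_saturate:
  "reach n k v m \<Longrightarrow> (\<exists>N B. saturated n k v m N B) \<or> extendable n k v m"
proof (induction rule: reach.induct)
  case reach_0
  then show ?case by (blast intro: saturated_0)
next
  case (reach_Suc k v m bs)
  let ?u = "row_word bs (n - k) v" and ?c = "count_list bs True"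
  from reach_Suc.IH show ?case
  proof
    assume "extendable n k v m"
    then show ?thesis using extendable_row_word reach_Suc.hyps by blast
  next
    assume "\<exists>N B. saturated n k v m N B"
    then obtain N B where S: "saturated n k v m N B" by blast
    have "length bs = length v" using reach_Suc.hyps reach_length by metis
    from row_word_saturate[OF this, of "n - k"] show ?thesis
    proof
      assume "\<exists>A. sweep (n - k) v ?c ?u A"
      then show ?thesis using saturated_Suc[OF S reach_Suc.hyps(2)] by blast
    next
      assume "\<exists>bs'. length bs' = length bs \<and> row_word bs' (n - k) v = ?u \<and>
        count_list bs' True = Suc ?c"
      then obtain bs' where bs': "length bs' = k" "row_word bs' (n - k) v = ?u"
          "count_list bs' True = Suc ?c" using reach_Suc.hyps by auto
      have "m + Poly_Mapping.single (n - k) ?c + monom_var (n - k) =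
        m + Poly_Mapping.single (n - k) (Suc ?c)"
        by (simp add: monom_var_def add.assoc single_add[symmetric])
      then have "reach n (Suc k) ?u (m + Poly_Mapping.single (n - k) ?c + monom_var (n - k))"
        using reach.reach_Suc[OF reach_Suc.hyps(1,2) bs'(1)] bs' by metis
      moreover have "n - k \<in> {1..n}" using reach_Suc.hyps by auto
      ultimately show ?thesis unfolding extendable_def by blast
    qed
  qed
qed

section \<open>Exchanging two pipes at a rise\<close>

inductive swap_rise :: "nat list \<Rightarrow> nat list \<Rightarrow> bool" where
  swap_rise_here: "x < y \<Longrightarrow> swap_rise (x # y # v) (y # x # v)"
| swap_rise_later: "swap_rise v v' \<Longrightarrow> swap_rise (x # v) (x # v')"


lemma swap_rise_mset: "swap_rise v v' \<Longrightarrow> mset v' = mset v"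
  by (induction rule: swap_rise.induct) auto

lemma swap_rise_less: "swap_rise v v' \<Longrightarrow> rises v' < rises v"
proof (induction rule: swap_rise.induct)
  case (swap_rise_later v v' x)
  then show ?case by (simp add: swap_rise_mset)
qed auto

text \<open>If the two exchanged entries of \<open>u\<close> were adjacent at the same columns below the row (with
  one possibly replaced by the pipe \<open>x\<close> that leaves), the exchange is passed down. Otherwise
  \<open>h\<close> was put down by a voluntary bump of \<open>x\<close>, which was put down next. Making this tile
  a cross exchanges them. The row then gains a cross, unless \<open>x\<close> was put down by a forced
  cross on some \<open>z\<close> with \<open>h < z\<close>, which becomes a voluntary bump.\<close>

lemma sweep_swap_rise:
  "sweep h v a u B \<Longrightarrow> swap_rise u u' \<Longrightarrow>
     (\<exists>B'. sweep h v a u' B') \<or> (\<exists>B'. sweep h v (Suc a) u' B') \<or>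
     (\<exists>v' B'. swap_rise v v' \<and> sweep h v' a u' B')"
proof (induction arbitrary: u' rule: sweep.induct)
  case (sweep_Nil h)
  then show ?case by (auto elim: swap_rise.cases)
next
  case (sweep_pass h x v a u B)
  from sweep_pass.prems show ?case
  proof (cases rule: swap_rise.cases)
    case (swap_rise_here y w)
    from sweep_pass.hyps(2)[unfolded swap_rise_here] show ?thesis
    proof (cases rule: sweep.cases)
      case (sweep_pass v'' a')
      have "sweep h (y # x # v'') (Suc a) u' B"
        using swap_rise_here \<open>h < x\<close> sweep.sweep_pass[OF _ sweep.sweep_pass[OF \<open>h < x\<close> sweep_pass(4)], of y]
          sweep_pass by simp
      then show ?thesis using swap_rise.swap_rise_here[of x y] swap_rise_here sweep_pass by blast
    qed (use swap_rise_here sweep_pass.hyps in auto)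
  next
    case (swap_rise_later w)
    then show ?thesis
      using sweep_pass.IH[of w] sweep.sweep_pass[OF \<open>h < x\<close>] swap_rise.swap_rise_later by metis
  qed
next
  case (sweep_vol h x v a u B)
  from sweep_vol.prems show ?case
  proof (cases rule: swap_rise.cases)
    case (swap_rise_here y w)
    from sweep_vol.hyps(2)[unfolded swap_rise_here] show ?thesis
    proof (cases rule: sweep.cases)
      case sweep_Nil
      have "sweep h [x] (Suc 0) [x, h] {#}"
        using sweep.sweep_pass[OF \<open>h < x\<close> sweep.sweep_Nil] by simp
      then show ?thesis using swap_rise_here sweep_Nil by auto
    next
      case (sweep_pass v'' a')
      have "sweep h (y # x # v'') a u' (add_mset x B)"
        using swap_rise_here sweep.sweep_pass[OF _ sweep.sweep_vol[OF \<open>h < x\<close> sweep_pass(4)], of y]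
          sweep_pass by simp
      then show ?thesis using swap_rise.swap_rise_here[of x y] swap_rise_here sweep_pass by blast
    next
      case (sweep_vol z v'' B'')
      have "sweep h (x # z # v'') (Suc a) u' (add_mset z B'')"
        using swap_rise_here sweep.sweep_pass[OF \<open>h < x\<close> sweep.sweep_vol[OF _ sweep_vol(5)]]
          sweep_vol \<open>h < x\<close> by simp
      then show ?thesis using sweep_vol by blast
    next
      case (sweep_forced z v'' a')
      show ?thesis
      proof (cases "h < z")
        case True
        have "sweep h (x # z # v'') a u' (add_mset z B)"
          using swap_rise_here sweep.sweep_pass[OF \<open>h < x\<close> sweep.sweep_vol[OF True sweep_forced(5)]]
            sweep_forced by simp
        then show ?thesis using sweep_forced by blast
      next
        case False
        have "sweep h (x # z # v'') (Suc a) u' B"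
          using swap_rise_here sweep.sweep_pass[OF \<open>h < x\<close> sweep.sweep_forced[OF _ sweep_forced(5)]]
            sweep_forced False by simp
        then show ?thesis using sweep_forced by blast
      qed
    qed
  next
    case (swap_rise_later w)
    then show ?thesis
      using sweep_vol.IH[of w] sweep.sweep_vol[OF \<open>h < x\<close>] swap_rise.swap_rise_later by metis
  qed
next
  case (sweep_forced x h v a u B)
  from sweep_forced.prems show ?case
  proof (cases rule: swap_rise.cases)
    case (swap_rise_here y w)
    from sweep_forced.hyps(2)[unfolded swap_rise_here] show ?thesis
    proof (cases rule: sweep.cases)
      case (sweep_pass v'' a')
      have "sweep h (y # x # v'') (Suc a) u' B"
        using swap_rise_here sweep.sweep_pass[OF _ sweep.sweep_forced[OF \<open>x \<le> h\<close> sweep_pass(4)], of y]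
          sweep_pass by simp
      then show ?thesis using swap_rise.swap_rise_here[of x y] swap_rise_here sweep_pass by blast
    qed (use swap_rise_here sweep_forced.hyps in auto)
  next
    case (swap_rise_later w)
    then show ?thesis
      using sweep_forced.IH[of w] sweep.sweep_forced[OF \<open>x \<le> h\<close>] swap_rise.swap_rise_later by metis
  qed
qed

text \<open>The exchange is pushed down until a row absorbs it. Every word that it goes through loses
  a rise, and the others stay as they are.\<close>

lemma saturated_swap_rise:
  "saturated n k u m N B \<Longrightarrow> swap_rise u u' \<Longrightarrow>
    (\<exists>N' B'. N' < N \<and> saturated n k u' m N' B') \<or> extendable n k u' m"
proof (induction arbitrary: u' rule: saturated.induct)
  case saturated_0
  then show ?case by (auto elim: swap_rise.cases)
next
  case (saturated_Suc k v m N B a u A)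
  have len: "length v = k" using saturated_word(2)[OF saturated_Suc.hyps(1)] .
  have less: "rises u' < rises u" using saturated_Suc.prems by (rule swap_rise_less)
  consider A' where "sweep (n - k) v a u' A'" | A' where "sweep (n - k) v (Suc a) u' A'"
    | v' A' where "swap_rise v v'" "sweep (n - k) v' a u' A'"
    using sweep_swap_rise[OF saturated_Suc.hyps(3) saturated_Suc.prems] by blast
  then show ?case
  proof cases
    case 1
    then show ?thesis
      using saturated.saturated_Suc[OF saturated_Suc.hyps(1,2) 1] less by (meson add_strict_left_mono)
  next
    case 2
    have "m + Poly_Mapping.single (n - k) a + monom_var (n - k) =
        m + Poly_Mapping.single (n - k) (Suc a)"
      by (simp add: monom_var_def add.assoc single_add[symmetric])
    then have "reach n (Suc k) u' (m + Poly_Mapping.single (n - k) a + monom_var (n - k))"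
      using reach_step[OF saturated_imp_reach[OF saturated_Suc.hyps(1)] saturated_Suc.hyps(2) 2 len]
      by metis
    moreover have "n - k \<in> {1..n}" using saturated_Suc.hyps by auto
    ultimately show ?thesis unfolding extendable_def by blast
  next
    case 3
    have len': "length v' = k" using swap_rise_mset[OF 3(1)] len mset_eq_length by metis
    from saturated_Suc.IH[OF 3(1)] show ?thesis
    proof
      assume "\<exists>N' B'. N' < N \<and> saturated n k v' m N' B'"
      then obtain N' B' where *: "N' < N" "saturated n k v' m N' B'" by blast
      have "N' + rises u' < N + rises u" using * less by simp
      then show ?thesis
        using saturated.saturated_Suc[OF *(2) saturated_Suc.hyps(2) 3(2)] by blast
    next
      assume "extendable n k v' m"
      then show ?thesis using extendable_sweep[OF _ saturated_Suc.hyps(2) 3(2) len'] by blast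
    qed
  qed
qed

fun ascends_to :: "nat \<Rightarrow> nat list \<Rightarrow> bool" where
  "ascends_to q (x # y # v) \<longleftrightarrow> x < y \<and> y = q \<or> ascends_to q (y # v)"
| "ascends_to q _ \<longleftrightarrow> False"

lemma ascends_to_Cons: "ascends_to q v \<Longrightarrow> ascends_to q (x # v)"
  by (cases v) auto

lemma ascends_to_ConsE:
  assumes "ascends_to q (x # v)"
  obtains "ascends_to q v" | v' where "v = q # v'" "x < q"
  using assms by (cases v) auto

text \<open>Follow \<open>q\<close> through the row. If it is put down after a bump, or stays where it was with its
  left neighbour \<open>x\<close>, it has a smaller left neighbour afterwards. Otherwise the carried \<open>q\<close>
  passes the next entry, or \<open>x\<close> is picked up and passes \<open>q\<close> while \<open>h\<close> is put down in the place
  of \<open>x\<close>. Unless such an \<open>h\<close> is a new smaller neighbour of \<open>q\<close>, the exchange applies: if of two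
  adjacent entries \<open>x < y\<close> the first is picked up by \<open>h\<close> and passes the second, then on
  the word with \<open>y\<close> before \<open>x\<close> the same \<open>h\<close> picks up \<open>y\<close>, which is put down on \<open>x\<close> by a forced
  cross, with the same result.\<close>

lemma sweep_bumped:
  "sweep h v a u B \<Longrightarrow> q \<in># B \<or> ascends_to q v \<Longrightarrow>
    ascends_to q u \<or> (\<exists>v' B'. swap_rise v v' \<and> sweep h v' a u B')"
proof (induction rule: sweep.induct)
  case (sweep_Nil h)
  then show ?case by auto
next
  case (sweep_pass h x v a u B)
  have IH: ?case if "q \<in># B \<or> ascends_to q v"
    using sweep_pass.IH[OF that] ascends_to_Cons sweep.sweep_pass[OF \<open>h < x\<close>] swap_rise_later by metis
  show ?case
  proof (cases "q \<in># B \<or> ascends_to q v")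
    case False
    then obtain v' where v: "v = q # v'" "x < q"
      using sweep_pass.prems by (auto elim: ascends_to_ConsE)
    from sweep_pass.hyps(2)[unfolded v] show ?thesis
      by (cases rule: sweep.cases) (use v False \<open>h < x\<close> in auto)
  qed (use IH in blast)
next
  case (sweep_vol h x v a u B)
  have IH: ?case if "q \<in># B \<or> ascends_to q v"
    using sweep_vol.IH[OF that] ascends_to_Cons sweep.sweep_vol[OF \<open>h < x\<close>] swap_rise_later by metis
  consider "q \<in># B \<or> ascends_to q v" | "q = x"
    | v' where "q \<notin># B" "v = q # v'" "x < q"
    using sweep_vol.prems by (auto elim: ascends_to_ConsE)
  then show ?case
  proof cases
    case 2
    from sweep_vol.hyps(2) show ?thesis
    proof (cases rule: sweep.cases)
      case (sweep_pass y v' a' u')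
      have "sweep h (y # x # v') a (h # u) (add_mset y B)"
        using sweep.sweep_vol[OF _ sweep.sweep_forced[OF _ sweep_pass(5)], of h y]
          sweep_pass \<open>h < x\<close> by simp
      then show ?thesis using swap_rise_here[of x y v'] sweep_pass by blast
    qed (use 2 \<open>h < x\<close> in auto)
  next
    case (3 v')
    from sweep_vol.hyps(2)[unfolded 3] show ?thesis
    proof (cases rule: sweep.cases)
      case (sweep_pass a' u')
      have "sweep h (q # x # v') a (h # u) (add_mset q B)"
        using sweep.sweep_vol[OF _ sweep.sweep_forced[OF _ sweep_pass(4)], of h q]
          sweep_pass \<open>h < x\<close> 3 by simp
      then show ?thesis using swap_rise_here[of x q v'] 3 by blast
    qed (use 3 in auto)
  qed (use IH in blast)
next
  case (sweep_forced x h v a u B)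
  have IH: ?case if "q \<in># B \<or> ascends_to q v"
    using sweep_forced.IH[OF that] ascends_to_Cons sweep.sweep_forced[OF \<open>x \<le> h\<close>] swap_rise_later by metis
  show ?case
  proof (cases "q \<in># B \<or> ascends_to q v")
    case False
    then obtain v' where v: "v = q # v'" "x < q"
      using sweep_forced.prems by (auto elim: ascends_to_ConsE)
    from sweep_forced.hyps(2)[unfolded v] show ?thesis
    proof (cases rule: sweep.cases)
      case (sweep_pass a' u')
      show ?thesis
      proof (cases "h < q")
        case True
        then show ?thesis using sweep_pass by simp
      next
        case False
        have "sweep h (q # x # v') (Suc a) (h # u) B"
          using sweep.sweep_forced[OF _ sweep.sweep_forced[OF _ sweep_pass(4)], of q h]
            sweep_pass False v by simp
        then show ?thesis using swap_rise_here[of x q v'] v by blast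
      qed
    qed (use v False in auto)
  qed (use IH in blast)
qed

text \<open>Exchanging below the row where this is possible either extends the weight or lowers the
  number of rises.\<close>

lemma saturated_bumped:
  "saturated n k u m N B \<Longrightarrow> q \<in># B \<Longrightarrow>
    ascends_to q u \<or> (\<exists>N' B'. N' < N \<and> saturated n k u m N' B') \<or> extendable n k u m"
proof (induction rule: saturated.induct)
  case (saturated_Suc k v m N B a u A)
  have len: "length v = k" using saturated_word(2)[OF saturated_Suc.hyps(1)] .
  consider "q \<in># A \<or> ascends_to q v" | N' B' where "N' < N" "saturated n k v m N' B'"
    | "extendable n k v m"
    using saturated_Suc by auto
  then show ?case
  proof cases
    case 1
    from sweep_bumped[OF saturated_Suc.hyps(3) 1] show ?thesis
    proof
      assume "\<exists>v' A'. swap_rise v v' \<and> sweep (n - k) v' a u A'"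
      then obtain v' A' where v': "swap_rise v v'" "sweep (n - k) v' a u A'" by blast
      have len': "length v' = k" using swap_rise_mset[OF v'(1)] len mset_eq_length by metis
      from saturated_swap_rise[OF saturated_Suc.hyps(1) v'(1)] show ?thesis
      proof
        assume "\<exists>N' B'. N' < N \<and> saturated n k v' m N' B'"
        then show ?thesis
          using saturated.saturated_Suc[OF _ saturated_Suc.hyps(2) v'(2)]
          by (meson add_strict_right_mono)
      next
        assume "extendable n k v' m"
        then show ?thesis using extendable_sweep[OF _ saturated_Suc.hyps(2) v'(2) len'] by blast
      qed
    qed simp
  next
    case 2
    then show ?thesis
      using saturated.saturated_Suc[OF 2(2) saturated_Suc.hyps(2,3)] by (meson add_strict_right_mono)
  next
    case 3
    then show ?thesis using extendable_sweep[OF _ saturated_Suc.hyps(2,3) len] by blast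
  qed
qed simp

section \<open>Records and the maximal degree\<close>

fun position :: "nat \<Rightarrow> nat list \<Rightarrow> nat" where
  "position q [] = 0"
| "position q (x # v) = (if x = q then 0 else Suc (position q v))"

fun is_record :: "nat \<Rightarrow> nat list \<Rightarrow> bool" where
  "is_record q [] \<longleftrightarrow> True"
| "is_record q (x # v) \<longleftrightarrow> x = q \<or> x < q \<and> is_record q v"

lemma sweep_record_carried:
  assumes "sweep h v a u B" "h \<notin> set v" "is_record h u"
  shows "position h u = 0"
  using assms by (cases rule: sweep.cases) auto

text \<open>In front of the word, \<open>h\<close> moves \<open>q\<close> one place to the right. Being passed moves it back, and
  being bumped does not. Meeting a larger pipe is excluded, as that pipe would remain on
  the left of the record.\<close>

lemma sweep_record:
  "sweep h v a u B \<Longrightarrow> distinct (h # v) \<Longrightarrow> q \<in> set v \<Longrightarrow> is_record q u \<Longrightarrow>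
    is_record q (h # v) \<and> Suc (position q u) = position q (h # v) + count B q"
proof (induction rule: sweep.induct)
  case (sweep_pass h x v a u B)
  show ?case
  proof (cases "q = x")
    case True
    then have "q \<notin># B" using sweep_pass sweep_bumped_subset by fastforce
    then show ?thesis using sweep_pass True by (auto simp: not_in_iff)
  qed (use sweep_pass in auto)
next
  case (sweep_vol h x v a u B)
  show ?case
  proof (cases "q = x")
    \<comment> \<open>the bumped record is carried on, and it must be put down at once: otherwise it would
      pass a larger pipe\<close>
    case True
    then have "q \<notin># B" using sweep_vol sweep_bumped_subset by fastforce
    moreover have "position x u = 0"
      using sweep_record_carried[OF sweep_vol.hyps(2)] sweep_vol True by auto
    ultimately show ?thesis using sweep_vol True by (auto simp: not_in_iff)
  qed (use sweep_vol in auto)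
next
  case (sweep_forced x h v a u B)
  then show ?case by (cases "q = x") auto
qed simp

text \<open>Since the right-hand side depends only on the final word, all saturated pipe dreams of
  a permutation bump a record equally often.\<close>

lemma saturated_record:
  "saturated n k u m N B \<Longrightarrow> q \<in> set u \<Longrightarrow> is_record q u \<Longrightarrow> count B q = position q u"
proof (induction rule: saturated.induct)
  case (saturated_Suc k v m N B a u A)
  have set_u: "set u = insert (n - k) (set v)"
    using sweep_mset[OF saturated_Suc.hyps(3)] by (metis set_mset_add_mset_insert set_mset_mset)
  have new: "n - k \<notin> set v" and dist: "distinct v"
    using saturated_word[OF saturated_Suc.hyps(1)] by auto
  show ?case
  proof (cases "q = n - k")
    case True
    then have "q \<notin># B" "q \<notin># A"
      using new saturated_bumped_subset[OF saturated_Suc.hyps(1)]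
        sweep_bumped_subset[OF saturated_Suc.hyps(3)] by auto
    then show ?thesis
      using sweep_record_carried[OF saturated_Suc.hyps(3) new] saturated_Suc.prems True
      by (simp add: not_in_iff)
  next
    case False
    then have q: "q \<in> set v" using saturated_Suc.prems set_u by auto
    have "is_record q ((n - k) # v) \<and> Suc (position q u) = position q ((n - k) # v) + count A q"
      using sweep_record[OF saturated_Suc.hyps(3)] saturated_Suc.prems new dist q by auto
    then show ?thesis using saturated_Suc.IH[OF q] False by auto
  qed
qed simp

definition run_heads :: "nat list \<Rightarrow> nat list" where
  "run_heads u = map hd (decreasing_runs u)"

lemma run_heads_simps:
  "run_heads [x] = [x]"
  "run_heads (x # y # v) = x # (if x > y then tl (run_heads (y # v)) else run_heads (y # v))"
  by (auto simp: run_heads_def map_tl)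

lemma run_heads_Cons: obtains hs where "run_heads (x # v) = x # hs"
  by (cases v) (auto simp: run_heads_simps)

lemma ascends_to_run_head: "ascends_to q u \<Longrightarrow> q \<in> set (tl (run_heads u))"
proof (induction q u rule: ascends_to.induct)
  case (1 q x y v)
  obtain hs where "run_heads (y # v) = y # hs" by (rule run_heads_Cons)
  then show ?case using 1 by (auto simp: run_heads_simps)
qed auto

lemma run_head_record:
  "sorted_wrt (<) (run_heads u) \<Longrightarrow> q \<in> set (tl (run_heads u)) \<Longrightarrow> is_record q u"
proof (induction u rule: induct_list012)
  case (3 x y v)
  obtain hs where hs: "run_heads (y # v) = y # hs" by (rule run_heads_Cons)
  show ?case
  proof (cases "x > y")
    case True
    then have "sorted_wrt (<) (run_heads (y # v))"
      using 3(3) hs by (auto simp: run_heads_simps)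
    then show ?thesis using 3 hs True by (auto simp: run_heads_simps)
  next
    case False
    then show ?thesis using 3 hs by (auto simp: run_heads_simps)
  qed
qed (auto simp: run_heads_def)

text \<open>If only records were bumped, there would be at most as many voluntary bumps as in the
  pipe dream of \<open>m0\<close>, so the degree could not be smaller.\<close>

lemma saturated_extend:
  assumes top: "\<And>q. ascends_to q u \<Longrightarrow> is_record q u"
    and max: "saturated n k u m0 N0 B0"
  shows "saturated n k u m N B \<Longrightarrow> monom_degree m < monom_degree m0 \<Longrightarrow> extendable n k u m"
proof (induction N arbitrary: B rule: less_induct)
  case (less N)
  have "\<exists>q\<in>#B. \<not> is_record q u"
  proof (rule ccontr)
    assume "\<not> (\<exists>q\<in>#B. \<not> is_record q u)"
    moreover have "set_mset B \<subseteq> set u" "set_mset B0 \<subseteq> set u"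
      using saturated_bumped_subset less.prems(1) max by auto
    ultimately have "count B q \<le> count B0 q" for q
      using saturated_record[OF less.prems(1), of q] saturated_record[OF max, of q]
      by (cases "q \<in># B") (auto simp: not_in_iff)
    then have "size B \<le> size B0" by (simp add: size_mset_mono subseteq_mset_def)
    then show False
      using saturated_size[OF less.prems(1)] saturated_size[OF max] less.prems(2) by linarith
  qed
  then obtain q where q: "q \<in># B" "\<not> is_record q u" by blast
  then show ?case
    using saturated_bumped[OF less.prems(1) q(1)] top less.IH less.prems(2) by blast
qed

theorem mainTheorem3:
  fixes n :: nat and w :: "nat \<Rightarrow> nat" and m :: monom
  assumes "w permutes {1..n}"
    and "inverse_fireworks n w"
    and "m \<in> Supp (grothendieck n w)"
    and "monom_degree m < poly_degree (grothendieck n w)"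
  shows "\<exists>i\<in>{1..n}. m + monom_var i \<in> Supp (grothendieck n w)"
proof -
  let ?u = "one_line n (inv w)" and ?S = "Supp (grothendieck n w)"
  have "finite ?S" by (simp add: Supp_def)
  then have fin: "finite (insert 0 (monom_degree ` ?S))" by simp
  have "poly_degree (grothendieck n w) \<in> insert 0 (monom_degree ` ?S)"
    unfolding poly_degree_def using fin by (rule Max_in) simp
  then obtain m0 where m0: "m0 \<in> ?S" "monom_degree m0 = poly_degree (grothendieck n w)"
    using assms(4) by auto
  have le: "monom_degree m' \<le> monom_degree m0" if "m' \<in> ?S" for m'
    unfolding m0(2) poly_degree_def using fin that by (intro Max_ge) auto
  \<comment> \<open>a pipe dream of maximal degree is saturated\<close>
  have "\<not> extendable n n ?u m0"
    using le by (fastforce simp: extendable_def Supp_iff_reach monom_degree_add monom_var_def)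
  then obtain N0 B0 where max: "saturated n n ?u m0 N0 B0"
    using reach_saturate[of n n ?u m0] m0(1) by (auto simp: Supp_iff_reach)
  have top: "is_record q ?u" if "ascends_to q ?u" for q
    using run_head_record[OF _ ascends_to_run_head[OF that]] assms(2)
    by (simp add: inverse_fireworks_def fireworks_def run_heads_def)
  have "extendable n n ?u m"
    using reach_saturate[of n n ?u m] saturated_extend[OF top max] assms(3,4) m0(2)
    by (auto simp: Supp_iff_reach)
  then show ?thesis by (simp add: extendable_def Supp_iff_reach)
qed

end
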